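(* Let $\mathcal{T}\in\mathbb{R}^{I\times J\times K}$ and let $R\ge 1$. The minimization of $\mathfrak{J}_{red}(\mathbf{B},\mathbf{C})$ over $\mathbf{B}\in\mathbb{R}^{J\times R}$, $\mathbf{C}\in\mathbb{R}^{K\times R}$ is equivalent to the maximization problem $$\sup_{\mathbf{u}_1,\ldots,\mathbf{u}_{\bar R}}\ \sum_{r=1}^{\bar R}\langle \mathbf{u}_r,\mathbf{M}\mathbf{u}_r\rangle ,$$ where the supremum is over all systems $(\mathbf{u}_1,\ldots,\mathbf{u}_{\bar R})$ of vectors in $\mathbb{R}^{JK}$ that form an orthonormal basis of $\mathrm{range}(\mathbf{B}\odot\mathbf{C})$, with $\bar R=\mathrm{rank}(\mathbf{B}\odot\mathbf{C})$, for some $\mathbf{B}\in\mathbb{R}^{J\times R}$, $\mathbf{C}\in\mathbb{R}^{K\times R}$. The equivalence holds in the following sense. (i) If $(\mathbf{B},\mathbf{C})$ is a minimizer of $\mathfrak{J}_{red}$, then every orthonormal basis of $\mathrm{range}(\mathbf{B}\odot\mathbf{C})$ is a maximizer of $\sum_{r}\langle \mathbf{u}_r,\mathbf{M}\mathbf{u}_r\rangle$ over all systems $(\mathbf{u}_r)_r$ of vectors in $\mathbb{R}^{JK}$ that form an orthonormal basis of $\mathrm{range}(\mathbf{B}'\odot\mathbf{C}')$ for some $\mathbf{B}'\in\mathbb{R}^{J\times R}$, $\mathbf{C}'\in\mathbb{R}^{K\times R}$. Likewise, if $(\mathbf{B}_n,\mathbf{C}_n)_n$ is a minimizing sequence of $\mathfrak{J}_{red}$,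 then any choice of orthonormal bases of $\mathrm{range}(\mathbf{B}_n\odot\mathbf{C}_n)$ is a maximizing sequence. (ii) Conversely, if $(\mathbf{u}_1,\ldots,\mathbf{u}_{\bar R})$ is a maximizer of $\sum_{r}\langle \mathbf{u}_r,\mathbf{M}\mathbf{u}_r\rangle$ over all systems $(\mathbf{u}_r)_r$ of vectors in $\mathbb{R}^{JK}$ that form an orthonormal basis of $\mathrm{range}(\mathbf{B}'\odot\mathbf{C}')$ for some $\mathbf{B}'\in\mathbb{R}^{J\times R}$, $\mathbf{C}'\in\mathbb{R}^{K\times R}$, then any associated $(\mathbf{B},\mathbf{C})$ (i.e. such that $\mathbf{u}_1,\ldots,\mathbf{u}_{\bar R}$ is an orthonormal basis of $\mathrm{range}(\mathbf{B}\odot\mathbf{C})$) is a minimizer of $\mathfrak{J}_{red}$. Likewise, the pairs $(\mathbf{B}_n,\mathbf{C}_n)$ associated with a maximizing sequence form a minimizing sequence of $\mathfrak{J}_{red}$.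
   Context: $I,J,K,R$ are positive integers. For $\mathbf{A}\in\mathbb{R}^{I\times R}$, $\mathbf{B}\in\mathbb{R}^{J\times R}$, $\mathbf{C}\in\mathbb{R}^{K\times R}$ with entries $a_{ir},b_{jr},c_{kr}$, $$\mathfrak{J}(\mathbf{A},\mathbf{B},\mathbf{C})=\tfrac12\sum_{i,j,k}\Big(\mathcal{T}_{ijk}-\sum_{r=1}^R a_{ir}b_{jr}c_{kr}\Big)^2,\qquad \mathfrak{J}_{red}(\mathbf{B},\mathbf{C})=\min_{\mathbf{A}\in\mathbb{R}^{I\times R}}\mathfrak{J}(\mathbf{A},\mathbf{B},\mathbf{C})$$ (the minimum is attained, being a finite-dimensional linear least-squares problem). The Kronecker product $\mathbf{b}\otimes\mathbf{c}\in\mathbb{R}^{JK}$ of $\mathbf{b}\in\mathbb{R}^J$, $\mathbf{c}\in\mathbb{R}^K$ has entry $b_jc_k$ at position $j+(k-1)J$. The Khatri-Rao product $\mathbf{B}\odot\mathbf{C}\in\mathbb{R}^{JK\times R}$ is the matrix with columns $\mathbf{b}_r\otimes\mathbf{c}_r$, $r=1,\dots,R$, where $\mathbf{b}_r,\mathbf{c}_r$ are the columns of $\mathbf{B},\mathbf{C}$. $\mathbf{M}\in\mathbb{R}^{JK\times JK}$ is the symmetric matrix whose entry at row $\alpha+(\beta-1)J$ and column $\gamma+(\delta-1)J$ is $\sum_{i=1}^I\mathcal{T}_{i\alpha\beta}\mathcal{T}_{i\gamma\delta}$, for $1\le\alpha,\gamma\le J$, $1\le\beta,\delta\le K$. A minimizing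 (maximizing) sequence is a sequence of admissible points along which the objective converges to its infimum (supremum). An empty sum is $0$. *)

theory Defs
  imports "HOL-Analysis.Analysis"
begin

text \<open>
  The dimensions I, J, K, R are the cardinalities of the finite index types 'i, 'j, 'k, 'r.
  A tensor of size I x J x K is a nested vector with entries \<open>T $ i $ j $ k\<close>.  Vectors of length JK
  are indexed by the product type \<open>'j \<times> 'k\<close>: the pair \<open>(j, k)\<close> stands for position j + (k-1)J.
\<close>

definition cost ::
    "real^'k^'j^'i \<Rightarrow> real^'r^'i \<Rightarrow> real^'r^'j \<Rightarrow> real^'r^'k \<Rightarrow> real"
  where "cost T A B C =
    1/2 * (\<Sum>i\<in>UNIV. \<Sum>j\<in>UNIV. \<Sum>k\<in>UNIV.
             (T $ i $ j $ k - (\<Sum>r\<in>UNIV. A $ i $ r * B $ j $ r * C $ k $ r))\<^sup>2)"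

text \<open>The infimum is a minimum; see \<open>cost_red_attained\<close> below.\<close>

definition cost_red :: "real^'k^'j^'i \<Rightarrow> real^'r^'j \<Rightarrow> real^'r^'k \<Rightarrow> real"
  where "cost_red T B C = (INF A. cost T A B C)"

definition kronecker :: "real^'j \<Rightarrow> real^'k \<Rightarrow> real^('j \<times> 'k)"
  where "kronecker b c = (\<chi> p. b $ fst p * c $ snd p)"

definition khatri_rao :: "real^'r^'j \<Rightarrow> real^'r^'k \<Rightarrow> real^'r^('j \<times> 'k)"
  where "khatri_rao B C = (\<chi> p r. kronecker (column r B) (column r C) $ p)"

definition M_mat :: "real^'k^'j^'i \<Rightarrow> real^('j \<times> 'k)^('j \<times> 'k)"
  where "M_mat T = (\<chi> p q. \<Sum>i\<in>UNIV. T $ i $ fst p $ snd p * T $ i $ fst q $ snd q)"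

definition objective :: "real^'k^'j^'i \<Rightarrow> (real^('j \<times> 'k)) list \<Rightarrow> real"
  where "objective T us = (\<Sum>r<length us. us ! r \<bullet> (M_mat T *v us ! r))"

definition orthonormal_basis :: "'a::real_inner list \<Rightarrow> 'a set \<Rightarrow> bool"
  where "orthonormal_basis us S \<longleftrightarrow>
    (\<forall>p<length us. \<forall>q<length us. us ! p \<bullet> us ! q = (if p = q then 1 else 0)) \<and> span (set us) = S"

definition associated ::
    "real^'r^'j \<Rightarrow> real^'r^'k \<Rightarrow> (real^('j \<times> 'k)) list \<Rightarrow> bool"
  where "associated B C us \<longleftrightarrow>
    length us = rank (khatri_rao B C) \<and> orthonormal_basis us (range ((*v) (khatri_rao B C)))"

text \<open>
  The admissible systems depend on R, which does not occur in the type of a system; hence the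
  type argument, to be instantiated with \<open>TYPE('r)\<close>.
\<close>

definition admissible :: "'r::finite itself \<Rightarrow> (real^('j::finite \<times> 'k::finite)) list \<Rightarrow> bool"
  where "admissible _ us \<longleftrightarrow> (\<exists>(B::real^'r^'j) (C::real^'r^'k). associated B C us)"

text \<open>
  The next two definitions use the \<open>Inf\<close> and \<open>Sup\<close> of the reals and are meaningful for objectives
  that are bounded below (above) on a nonempty admissible set; see the lemmas at the end.
\<close>

definition minimizing_sequence :: "('a \<Rightarrow> real) \<Rightarrow> 'a set \<Rightarrow> (nat \<Rightarrow> 'a) \<Rightarrow> bool"
  where "minimizing_sequence f S x \<longleftrightarrow>
    (\<forall>n. x n \<in> S) \<and> (\<lambda>n. f (x n)) \<longlonglongrightarrow> (INF y\<in>S. f y)"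

definition maximizing_sequence :: "('a \<Rightarrow> real) \<Rightarrow> 'a set \<Rightarrow> (nat \<Rightarrow> 'a) \<Rightarrow> bool"
  where "maximizing_sequence f S x \<longleftrightarrow>
    (\<forall>n. x n \<in> S) \<and> (\<lambda>n. f (x n)) \<longlonglongrightarrow> (SUP y\<in>S. f y)"

lemma cost_nonneg: "0 \<le> cost T A B C"
  unfolding cost_def by (intro mult_nonneg_nonneg sum_nonneg) auto

lemma cost_red_attained:
  fixes T :: "real^'k^'j^'i" and B :: "real^'r^'j" and C :: "real^'r^'k"
  shows "\<exists>A. cost T A B C = cost_red T B C \<and> (\<forall>A'. cost T A B C \<le> cost T A' B C)"
proof -
  define L :: "real^'r^'i \<Rightarrow> real^'k^'j^'i"
    where "L = (\<lambda>A. \<chi> i j k. \<Sum>r\<in>UNIV. A $ i $ r * B $ j $ r * C $ k $ r)"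
  have "linear L"
    by (rule linearI)
      (simp_all add: L_def vec_eq_iff algebra_simps sum.distrib sum_distrib_left)
  then have "closed (range L)"
    by (intro closed_subspace linear_subspace_image) auto
  then obtain x where "x \<in> range L" and x: "\<And>y. y \<in> range L \<Longrightarrow> dist T x \<le> dist T y"
    using distance_attains_inf[of "range L" T] by blast
  then obtain A where A: "dist T (L A) \<le> dist T (L A')" for A'
    by blast
  have eq: "cost T A' B C = (dist T (L A'))\<^sup>2 / 2" for A'
    unfolding dist_norm power2_norm_eq_inner
    by (simp add: cost_def L_def inner_vec_def power2_eq_square)
  have le: "cost T A B C \<le> cost T A' B C" for A'
    using A[of A'] by (simp add: eq power_mono)
  moreover have "cost_red T B C = cost T A B C"
    unfolding cost_red_def by (rule cInf_eq_minimum) (use le in auto)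
  ultimately show ?thesis by auto
qed

lemma cost_red_bdd_below:
  "bdd_below (range (\<lambda>(B :: real^'r^'j, C :: real^'r^'k). cost_red (T :: real^'k^'j^'i) B C))"
proof -
  have "0 \<le> cost_red T B C" for B :: "real^'r^'j" and C :: "real^'r^'k"
    unfolding cost_red_def by (rule cINF_greatest) (auto simp: cost_nonneg)
  then show ?thesis by (intro bdd_belowI[of _ 0]) auto
qed

lemma admissible_Nil:
  "admissible TYPE('r::finite) ([] :: (real^('j::finite \<times> 'k::finite)) list)"
proof -
  have z: "khatri_rao (0::real^'r^'j) (0::real^'r^'k) = 0"
    by (simp add: khatri_rao_def kronecker_def column_def vec_eq_iff)
  have "associated (0::real^'r^'j) (0::real^'r^'k) []"
    by (auto simp: associated_def orthonormal_basis_def z rank_dim_range image_constant_conv)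
  then show ?thesis unfolding admissible_def by blast
qed

lemma objective_bdd_above:
  fixes T :: "real^'k^'j^'i"
  shows "bdd_above (objective T ` {us. admissible TYPE('r::finite) us})"
proof (rule bdd_aboveI2)
  fix us :: "(real^('j \<times> 'k)) list"
  assume "us \<in> {us. admissible TYPE('r) us}"
  then obtain B :: "real^'r^'j" and C :: "real^'r^'k" where BC: "associated B C us"
    unfolding admissible_def by blast
  then have len: "length us = rank (khatri_rao B C)"
    by (simp add: associated_def)
  have on: "us ! p \<bullet> us ! p = 1" if "p < length us" for p
    using that BC by (auto simp: associated_def orthonormal_basis_def)
  have "us ! p \<bullet> (M_mat T *v us ! p) \<le> onorm ((*v) (M_mat T))" if "p < length us" for p
  proof -
    have n: "norm (us ! p) = 1" using on[OF that] by (simp add: norm_eq_1)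
    have "us ! p \<bullet> (M_mat T *v us ! p) \<le> norm (us ! p) * norm (M_mat T *v us ! p)"
      by (rule norm_cauchy_schwarz)
    also have "\<dots> \<le> onorm ((*v) (M_mat T))"
      using onorm[OF matrix_vector_mul_bounded_linear, of "M_mat T" "us ! p"] n by simp
    finally show ?thesis .
  qed
  then have "objective T us \<le> real (length us) * onorm ((*v) (M_mat T))"
    unfolding objective_def
    using sum_bounded_above[of "{..<length us}" "\<lambda>p. us ! p \<bullet> (M_mat T *v us ! p)"] by simp
  also have "\<dots> \<le> real CARD('r) * onorm ((*v) (M_mat T))"
    using rank_bound[of "khatri_rao B C"] len
    by (intro mult_right_mono onorm_pos_le matrix_vector_mul_bounded_linear) auto
  finally show "objective T us \<le> real CARD('r) * onorm ((*v) (M_mat T))" .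
qed

end

theory Submission
  imports Defs
begin

text \<open>
  Everything follows from one identity: if \<open>us\<close> is an orthonormal basis of
  \<open>range (B \<odot> C)\<close>, then \<open>cost_red T B C = (\<parallel>T\<parallel>\<^sup>2 - objective T us) / 2\<close>
  (lemma \<open>cost_red_eq_objective\<close>).
  Writing \<open>t\<^sub>i\<close> for the \<open>i\<close>-th slice of the tensor, flattened to a vector, the cost is
  \<open>\<Sum>\<^sub>i \<parallel>t\<^sub>i - (B \<odot> C) a\<^sub>i\<parallel>\<^sup>2 / 2\<close> with \<open>a\<^sub>i\<close> the \<open>i\<close>-th row of \<open>A\<close>.  The rows can be
  chosen independently, so the minimum over \<open>A\<close> is reached when each \<open>(B \<odot> C) a\<^sub>i\<close> is the orthogonal
  projection of \<open>t\<^sub>i\<close> onto \<open>range (B \<odot> C)\<close>, and the residual is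
  \<open>\<parallel>t\<^sub>i\<parallel>\<^sup>2 - \<Sum>\<^sub>r \<langle>u\<^sub>r, t\<^sub>i\<rangle>\<^sup>2\<close>.  Since \<open>M\<close> is the sum of the rank-one
  matrices \<open>t\<^sub>i t\<^sub>i\<^sup>T\<close>, the subtracted terms add up to the objective.

  Every pair \<open>(B, C)\<close> has an associated system, so the values of the objective on admissible systems
  are precisely the values \<open>\<parallel>T\<parallel>\<^sup>2 - 2 x\<close> for \<open>x\<close> a value of the reduced cost.
  This decreasing affine map exchanges minimizers with maximizers and the infimum with the supremum,
  hence minimizing with maximizing sequences.
\<close>

text \<open>
  The vector \<open>p\<close> is the orthogonal projection of \<open>t\<close> onto \<open>S\<close>, expanded in an orthonormal basis.
\<close>

lemma orthonormal_projection:
  fixes t :: "'a::real_inner"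
  assumes "orthonormal_basis us S"
  defines "p \<equiv> \<Sum>r<length us. (us ! r \<bullet> t) *\<^sub>R us ! r"
  shows orthonormal_projection_in: "p \<in> S"
    and orthonormal_projection_residual: "(norm (t - p))\<^sup>2 = (norm t)\<^sup>2 - (\<Sum>r<length us. (us ! r \<bullet> t)\<^sup>2)"
    and orthonormal_projection_closest: "\<And>y. y \<in> S \<Longrightarrow> norm (t - p) \<le> norm (t - y)"
proof -
  have on: "us ! r \<bullet> us ! q = (if r = q then 1 else 0)" if "r < length us" "q < length us" for r q
    using assms(1) that by (auto simp: orthonormal_basis_def)
  have S: "S = span (set us)"
    using assms(1) by (auto simp: orthonormal_basis_def)
  show pS: "p \<in> S"
    unfolding p_def S by (intro span_sum span_scale span_base nth_mem) auto
  have "(t - p) \<bullet> us ! q = 0" if q: "q < length us" for q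
  proof -
    have "p \<bullet> us ! q = (\<Sum>r<length us. if r = q then us ! q \<bullet> t else 0)"
      unfolding p_def inner_sum_left by (rule sum.cong) (auto simp: on q)
    then show ?thesis
      using q by (simp add: inner_diff_left inner_commute)
  qed
  then have "orthogonal (t - p) x" if "x \<in> set us" for x
    using that by (auto simp: in_set_conv_nth orthogonal_def)
  then have orth: "(t - p) \<bullet> y = 0" if "y \<in> S" for y
    using that orthogonal_to_span[of y "set us" "t - p"] by (auto simp: S orthogonal_def)
  have tp: "t \<bullet> p = (\<Sum>r<length us. (us ! r \<bullet> t)\<^sup>2)"
    by (simp add: p_def inner_sum_right power2_eq_square inner_commute)
  have "(norm (t - p))\<^sup>2 = (t - p) \<bullet> t - (t - p) \<bullet> p"
    by (simp add: power2_norm_eq_inner inner_diff_right)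
  also have "\<dots> = t \<bullet> t - t \<bullet> p"
    by (simp only: orth[OF pS]) (simp add: inner_diff_left inner_commute[of p])
  finally show "(norm (t - p))\<^sup>2 = (norm t)\<^sup>2 - (\<Sum>r<length us. (us ! r \<bullet> t)\<^sup>2)"
    by (simp add: tp power2_norm_eq_inner)
  show "norm (t - p) \<le> norm (t - y)" if y: "y \<in> S" for y
  proof -
    have "p - y \<in> S"
      using pS y unfolding S by (rule span_diff)
    then have "orthogonal (t - p) (p - y)"
      by (simp add: orth orthogonal_def)
    then have "(norm (t - y))\<^sup>2 = (norm (t - p))\<^sup>2 + (norm (p - y))\<^sup>2"
      using norm_add_Pythagorean[of "t - p" "p - y"] by simp
    then show ?thesis
      by (simp add: power2_le_imp_le)
  qed
qed

text \<open>The \<open>i\<close>-th slice of a tensor, as a vector in the same coordinates as a Kronecker product.\<close>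

definition slice :: "real^'k^'j^'i \<Rightarrow> 'i \<Rightarrow> real^('j \<times> 'k)"
  where "slice T i = (\<chi> p. T $ i $ fst p $ snd p)"

text \<open>The rows of \<open>A\<close> enter different summands, so each can be optimized on its own.\<close>

lemma cost_eq_slices:
  "cost T A B C = 1/2 * (\<Sum>i\<in>UNIV. (norm (slice T i - khatri_rao B C *v (A $ i)))\<^sup>2)"
  unfolding cost_def power2_norm_eq_inner
  by (simp only: sum.cartesian_product UNIV_Times_UNIV)
    (simp add: sum.cartesian_product inner_vec_def slice_def khatri_rao_def kronecker_def column_def
      matrix_vector_mult_def power2_eq_square case_prod_unfold mult_ac)

text \<open>\<open>M\<close> is the sum over \<open>i\<close> of the outer products of the slices with themselves.\<close>

lemma inner_M_mat:
  fixes T :: "real^'k^'j^'i"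
  shows "u \<bullet> (M_mat T *v u) = (\<Sum>i\<in>UNIV. (u \<bullet> slice T i)\<^sup>2)"
proof -
  have "M_mat T *v u = (\<Sum>i\<in>UNIV. (u \<bullet> slice T i) *\<^sub>R slice T i)"
  proof (rule vec_eq_iff[THEN iffD2], rule allI)
    fix p
    have "(M_mat T *v u) $ p =
        (\<Sum>q\<in>UNIV. \<Sum>i\<in>UNIV. slice T i $ p * (slice T i $ q * u $ q))"
      by (simp add: M_mat_def matrix_vector_mult_def slice_def sum_distrib_left sum_distrib_right mult_ac)
    also have "\<dots> = (\<Sum>i\<in>UNIV. \<Sum>q\<in>UNIV. slice T i $ p * (slice T i $ q * u $ q))"
      by (rule sum.swap)
    also have "\<dots> = (\<Sum>i\<in>UNIV. (u \<bullet> slice T i) *\<^sub>R slice T i) $ p"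
      by (simp add: inner_vec_def sum_distrib_left sum_distrib_right mult_ac)
    finally show "(M_mat T *v u) $ p = (\<Sum>i\<in>UNIV. (u \<bullet> slice T i) *\<^sub>R slice T i) $ p" .
  qed
  then show ?thesis
    by (simp add: inner_sum_right power2_eq_square)
qed

lemma objective_eq_slices:
  "objective T us = (\<Sum>i\<in>UNIV. \<Sum>r<length us. (us ! r \<bullet> slice T i)\<^sup>2)"
  unfolding objective_def inner_M_mat by (rule sum.swap)

lemma norm_tensor_eq_slices: "(norm T)\<^sup>2 = (\<Sum>i\<in>UNIV. (norm (slice T i))\<^sup>2)"
  unfolding power2_norm_eq_inner
  by (simp add: inner_vec_def slice_def sum.cartesian_product case_prod_unfold)

lemma cost_red_eq_objective:
  fixes T :: "real^'k^'j^'i" and B :: "real^'r^'j" and C :: "real^'r^'k"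
  assumes "associated B C us"
  shows "cost_red T B C = ((norm T)\<^sup>2 - objective T us) / 2"
proof -
  let ?KR = "khatri_rao B C"
  define p where "p i = (\<Sum>r<length us. (us ! r \<bullet> slice T i) *\<^sub>R us ! r)" for i
  have onb: "orthonormal_basis us (range ((*v) ?KR))"
    using assms by (simp add: associated_def)
  have "p i \<in> range ((*v) ?KR)" for i
    unfolding p_def by (rule orthonormal_projection_in[OF onb])
  then have "\<forall>i. \<exists>a. ?KR *v a = p i"
    by (metis rangeE)
  then obtain a where a: "\<And>i. ?KR *v a i = p i"
    using choice[of "\<lambda>i a. ?KR *v a = p i"] by blast
  define A where "A = (\<chi> i. a i)"
  have "cost T A B C = 1/2 * (\<Sum>i\<in>UNIV. (norm (slice T i - p i))\<^sup>2)"
    by (simp add: cost_eq_slices A_def a)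
  also have "\<dots> = ((norm T)\<^sup>2 - objective T us) / 2"
    unfolding p_def orthonormal_projection_residual[OF onb]
    by (simp add: objective_eq_slices norm_tensor_eq_slices sum_subtractf)
  finally have A: "cost T A B C = ((norm T)\<^sup>2 - objective T us) / 2" .
  have "cost T A B C \<le> cost T A' B C" for A'
    unfolding cost_eq_slices
    using orthonormal_projection_closest[OF onb, of "?KR *v (A' $ i)" "slice T i" for i]
    by (auto intro!: sum_mono power_mono simp: A_def a p_def)
  then have "cost_red T B C = cost T A B C"
    unfolding cost_red_def by (intro cInf_eq_minimum) auto
  then show ?thesis
    by (simp add: A)
qed

lemma associated_exists:
  fixes B :: "real^'r^'j" and C :: "real^'r^'k"
  shows "\<exists>us. associated B C us"
proof -
  let ?S = "range ((*v) (khatri_rao B C))"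
  have S: "subspace ?S"
    by (intro linear_subspace_image) auto
  obtain E where E: "pairwise orthogonal E" "\<And>x. x \<in> E \<Longrightarrow> norm x = 1"
      "independent E" "card E = dim ?S" "span E = ?S"
    using orthonormal_basis_subspace[OF S] by metis
  obtain us where us: "set us = E" "distinct us"
    using finite_distinct_list[OF independent_imp_finite[OF E(3)]] by blast
  have "length us = rank (khatri_rao B C)"
    using E(4) us distinct_card[of us] by (simp add: rank_dim_range)
  moreover have "us ! p \<bullet> us ! q = (if p = q then 1 else 0)"
    if "p < length us" "q < length us" for p q
    using that E(1,2) us nth_mem[of p us] nth_mem[of q us] nth_eq_iff_index_eq[of us p q]
    by (auto simp: pairwise_def orthogonal_def norm_eq_1)
  ultimately have "associated B C us"
    using E(5) us by (auto simp: associated_def orthonormal_basis_def)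
  then show ?thesis ..
qed

text \<open>
  The set of objective values is the image of the set of reduced costs under the map
  \<open>x \<mapsto> \<parallel>T\<parallel>\<^sup>2 - 2 x\<close>, which is continuous and antitone and therefore sends the infimum to
  the supremum.  That every reduced cost corresponds to an objective value uses the existence of
  associated systems.
\<close>

lemma SUP_objective_eq_INF_cost_red:
  fixes T :: "real^'k^'j^'i"
  shows "(SUP us\<in>{us. admissible TYPE('r::finite) us}. objective T us) =
    (norm T)\<^sup>2 - 2 * (INF (B::real^'r^'j, C::real^'r^'k)\<in>UNIV. cost_red T B C)"
proof -
  let ?X = "range (\<lambda>(B::real^'r^'j, C::real^'r^'k). cost_red T B C)"
  let ?h = "\<lambda>x. (norm T)\<^sup>2 - 2 * x"
  have obj: "objective T us = ?h (cost_red T B C)"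
    if "associated B C us" for us and B :: "real^'r^'j" and C :: "real^'r^'k"
    using cost_red_eq_objective[OF that, of T] by simp
  have "objective T ` {us. admissible TYPE('r) us} = ?h ` ?X"
  proof (intro equalityI subsetI)
    fix y assume "y \<in> objective T ` {us. admissible TYPE('r) us}"
    then obtain us and B :: "real^'r^'j" and C :: "real^'r^'k"
      where "y = objective T us" "associated B C us"
      by (auto simp: admissible_def)
    then have "y = ?h (case (B, C) of (B, C) \<Rightarrow> cost_red T B C)"
      by (simp add: obj)
    then show "y \<in> ?h ` ?X"
      by blast
  next
    fix y assume "y \<in> ?h ` ?X"
    then obtain B :: "real^'r^'j" and C :: "real^'r^'k" where y: "y = ?h (cost_red T B C)"
      by auto
    obtain us where us: "associated B C us"
      using associated_exists by blast
    then have "y = objective T us"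
      by (simp add: y obj)
    then show "y \<in> objective T ` {us. admissible TYPE('r) us}"
      using us by (auto simp: admissible_def)
  qed
  moreover have "?h (Inf ?X) = (SUP x\<in>?X. ?h x)"
    by (rule continuous_at_Inf_antimono)
      (auto intro!: antimonoI cost_red_bdd_below continuous_diff continuous_mult)
  ultimately show ?thesis
    by simp
qed

theorem theorem3p6:
  fixes T :: "real^'k::finite^'j::finite^'i::finite"
  shows
    "(\<forall>(B :: real^'r::finite^'j) (C :: real^'r^'k) us.
        is_arg_min (\<lambda>(B, C). cost_red T B C) (\<lambda>_. True) (B, C) \<longrightarrow>
        associated B C us \<longrightarrow>
        is_arg_max (objective T) (admissible TYPE('r)) us)
     \<and>
     (\<forall>(B :: nat \<Rightarrow> real^'r^'j) (C :: nat \<Rightarrow> real^'r^'k) us.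
        minimizing_sequence (\<lambda>(B, C). cost_red T B C) UNIV (\<lambda>n. (B n, C n)) \<longrightarrow>
        (\<forall>n. associated (B n) (C n) (us n)) \<longrightarrow>
        maximizing_sequence (objective T) {vs. admissible TYPE('r) vs} us)
     \<and>
     (\<forall>us (B :: real^'r^'j) (C :: real^'r^'k).
        is_arg_max (objective T) (admissible TYPE('r)) us \<longrightarrow>
        associated B C us \<longrightarrow>
        is_arg_min (\<lambda>(B, C). cost_red T B C) (\<lambda>_. True) (B, C))
     \<and>
     (\<forall>us (B :: nat \<Rightarrow> real^'r^'j) (C :: nat \<Rightarrow> real^'r^'k).
        maximizing_sequence (objective T) {vs. admissible TYPE('r) vs} us \<longrightarrow>
        (\<forall>n. associated (B n) (C n) (us n)) \<longrightarrow>
        minimizing_sequence (\<lambda>(B, C). cost_red T B C) UNIV (\<lambda>n. (B n, C n)))"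
proof -
  let ?N = "(norm T)\<^sup>2"
  let ?inf = "INF (B::real^'r^'j, C::real^'r^'k)\<in>UNIV. cost_red T B C"
  let ?sup = "SUP us\<in>{us. admissible TYPE('r) us}. objective T us"
  have sup: "?sup = ?N - 2 * ?inf"
    by (rule SUP_objective_eq_INF_cost_red)
  have arg: "is_arg_min (\<lambda>(B, C). cost_red T B C) (\<lambda>_. True) (B, C) \<longleftrightarrow>
      is_arg_max (objective T) (admissible TYPE('r)) us"
    if BC: "associated B C us" for us and B :: "real^'r^'j" and C :: "real^'r^'k"
  proof -
    have adm: "admissible TYPE('r) us"
      using BC by (auto simp: admissible_def)
    \<comment> \<open>A strictly better pair exists iff a strictly better admissible system does.\<close>
    have "(\<exists>B' C'. cost_red T (B'::real^'r^'j) C' < cost_red T B C) \<longleftrightarrow>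
        (\<exists>B' C' vs. associated (B'::real^'r^'j) C' vs \<and> cost_red T B' C' < cost_red T B C)"
      using associated_exists by blast
    also have "\<dots> \<longleftrightarrow> (\<exists>B' C' vs. associated (B'::real^'r^'j) C' vs \<and>
        objective T us < objective T vs)"
      using cost_red_eq_objective[OF BC, of T] by (auto simp: cost_red_eq_objective cong: conj_cong)
    also have "\<dots> \<longleftrightarrow> (\<exists>vs. admissible TYPE('r) vs \<and> objective T us < objective T vs)"
      by (auto simp: admissible_def)
    finally show ?thesis
      unfolding is_arg_min_def is_arg_max_def
      using adm by (simp add: split_paired_Ex del: not_ex split_paired_All)
  qed
  have seq: "minimizing_sequence (\<lambda>(B, C). cost_red T B C) UNIV (\<lambda>n. (B n, C n)) \<longleftrightarrow>
      maximizing_sequence (objective T) {vs. admissible TYPE('r) vs} us"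
    if BC: "\<forall>n. associated (B n) (C n) (us n)"
    for us and B :: "nat \<Rightarrow> real^'r^'j" and C :: "nat \<Rightarrow> real^'r^'k"
  proof -
    have red: "cost_red T (B n) (C n) = (?N - objective T (us n)) / 2" for n
      using BC cost_red_eq_objective by blast
    have obj: "objective T (us n) = ?N - 2 * cost_red T (B n) (C n)" for n
      by (simp add: red field_simps)
    have "(\<lambda>n. cost_red T (B n) (C n)) \<longlonglongrightarrow> ?inf \<longleftrightarrow> (\<lambda>n. objective T (us n)) \<longlonglongrightarrow> ?sup"
    proof
      assume "(\<lambda>n. cost_red T (B n) (C n)) \<longlonglongrightarrow> ?inf"
      then show "(\<lambda>n. objective T (us n)) \<longlonglongrightarrow> ?sup"
        unfolding obj sup by (intro tendsto_intros)
    next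
      assume "(\<lambda>n. objective T (us n)) \<longlonglongrightarrow> ?sup"
      then have "(\<lambda>n. (?N - objective T (us n)) / 2) \<longlonglongrightarrow> (?N - ?sup) / 2"
        by (intro tendsto_intros) auto
      then show "(\<lambda>n. cost_red T (B n) (C n)) \<longlonglongrightarrow> ?inf"
        by (simp add: red sup)
    qed
    moreover have "admissible TYPE('r) (us n)" for n
      using BC by (auto simp: admissible_def)
    ultimately show ?thesis
      by (simp add: minimizing_sequence_def maximizing_sequence_def)
  qed
  show ?thesis
    using arg seq by blast
qed

end
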